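(* Let $G$ be a finite simple graph and $H$ a finite graph, possibly with loops. There exists a bijection \[ \phi : \operatorname{Hom}^{\mathrm{bsp}}(G \sqcup G, H) \to \operatorname{Hom}^{\mathrm{bsp}}(G \times K_2, H) \] obtained through application of the swapping operation, i.e. such that for every $f$ in the domain there is a set $W \subseteq V(G)$ with $\operatorname{pair}(\phi(f)) = \operatorname{swap}(\operatorname{pair}(f), W)$.
   Context: All graphs are finite and undirected; $G$ is simple; $H$ may have loops but no multiple edges. $\operatorname{Hom}(G,H)$ is the set of maps $f:V(G)\to V(H)$ with $f(u)f(v)\in E(H)$ for all $uv\in E(G)$ ($vv$ denotes a loop at $v$). Both $G \sqcup G$ and $G \times K_2$ have vertex set $\{v_i : v \in V(G), i \in \{0,1\}\}$; the edges of $G\sqcup G$ are $u_iv_i$ and the edges of $G\times K_2$ are $u_iv_{1-i}$, for $uv\in E(G)$ and $i\in\{0,1\}$. An $H$-pair-labeling of $G$ is any map $p=(p_0,p_1): V(G)\to V(H)\times V(H)$. For $f\in\operatorname{Hom}(G\sqcup G,H)$ or $f\in \operatorname{Hom}(G\times K_2,H)$, $\operatorname{pair}(f)$ is the $H$-pair-labeling $v\mapsto (f(v_0),f(v_1))$. An edge $uv\in E(G)$ is safe with respect to $p$ if $p_i(u)p_j(v)\in E(H)$ for all $i,j\in\{0,1\}$, and violated otherwise. A labeling $p$ has the bipartite swapping property if the edges of $G$ violated with respect to $p$ form a bipartite subgraph of $G$; a homomorphism $f\in\operatorname{Hom}(G\sqcup G,H)$ or $f\in\operatorname{Hom}(G\times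 K_2,H)$ has the bipartite swapping property if $\operatorname{pair}(f)$ does. $\operatorname{Hom}^{\mathrm{bsp}}(G\sqcup G,H)$ and $\operatorname{Hom}^{\mathrm{bsp}}(G\times K_2,H)$ denote the sets of homomorphisms in $\operatorname{Hom}(G\sqcup G,H)$, respectively $\operatorname{Hom}(G\times K_2,H)$, with the bipartite swapping property. For $W\subseteq V(G)$, $\operatorname{swap}(p,W)$ is the $H$-pair-labeling obtained from $p$ by exchanging the two entries of $p(v)$ for each $v\in W$ (and leaving $p(v)$ unchanged for $v\notin W$). *)

theory Defs
  imports "Graph_Theory.Pair_Digraph"
begin

text \<open>
  Undirected graphs are symmetric pair digraphs: an edge \<open>uv\<close> is the pair of arcs \<open>(u, v)\<close> and
  \<open>(v, u)\<close>, a loop is the arc \<open>(v, v)\<close>. \<^locale>\<open>pair_graph\<close> is a finite simple graph, and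
  \<^locale>\<open>pair_pseudo_graph\<close> a finite graph with loops allowed and no multiple edges.
\<close>

text \<open>Homomorphisms are extensional, so that distinct elements of \<open>Homs G H\<close> differ on \<open>V(G)\<close>.\<close>

definition Homs :: "'a pair_pre_digraph \<Rightarrow> 'b pair_pre_digraph \<Rightarrow> ('a \<Rightarrow> 'b) set" where
  "Homs G H = {f \<in> pverts G \<rightarrow>\<^sub>E pverts H. \<forall>(u, v) \<in> parcs G. (f u, f v) \<in> parcs H}"

text \<open>\<open>G \<squnion> G\<close> and \<open>G \<times> K\<^sub>2\<close>; the vertex \<open>v\<^sub>i\<close> is \<open>(v, i)\<close> with \<open>i \<in> {0, 1}\<close>.\<close>

definition two_copies :: "'a pair_pre_digraph \<Rightarrow> ('a \<times> nat) pair_pre_digraph" where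
  "two_copies G =
     \<lparr> pverts = pverts G \<times> {0, 1},
       parcs = {((u, i), (v, i)) | u v i. (u, v) \<in> parcs G \<and> i \<in> {0, 1}} \<rparr>"

definition times_K2 :: "'a pair_pre_digraph \<Rightarrow> ('a \<times> nat) pair_pre_digraph" where
  "times_K2 G =
     \<lparr> pverts = pverts G \<times> {0, 1},
       parcs = {((u, i), (v, 1 - i)) | u v i. (u, v) \<in> parcs G \<and> i \<in> {0, 1}} \<rparr>"

text \<open>
  An \<open>H\<close>-pair-labeling of \<open>G\<close> is an element of \<open>pverts G \<rightarrow>\<^sub>E pverts H \<times> pverts H\<close>, with entries
  indexed by 0 and 1.
\<close>

definition pair_of :: "'a pair_pre_digraph \<Rightarrow> ('a \<times> nat \<Rightarrow> 'b) \<Rightarrow> 'a \<Rightarrow> 'b \<times> 'b" where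
  "pair_of G f = (\<lambda>v \<in> pverts G. (f (v, 0), f (v, 1)))"

definition entry :: "('a \<Rightarrow> 'b \<times> 'b) \<Rightarrow> nat \<Rightarrow> 'a \<Rightarrow> 'b" where
  "entry p i v = (if i = 0 then fst (p v) else snd (p v))"

definition safe_edge :: "'b pair_pre_digraph \<Rightarrow> ('a \<Rightarrow> 'b \<times> 'b) \<Rightarrow> 'a \<times> 'a \<Rightarrow> bool" where
  "safe_edge H p = (\<lambda>(u, v). \<forall>i \<in> {0, 1}. \<forall>j \<in> {0, 1}. (entry p i u, entry p j v) \<in> parcs H)"

definition violated_subgraph ::
    "'a pair_pre_digraph \<Rightarrow> 'b pair_pre_digraph \<Rightarrow> ('a \<Rightarrow> 'b \<times> 'b) \<Rightarrow> 'a pair_pre_digraph" where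
  "violated_subgraph G H p =
     \<lparr> pverts = pverts G, parcs = {e \<in> parcs G. \<not> safe_edge H p e} \<rparr>"

definition bipartite :: "'a pair_pre_digraph \<Rightarrow> bool" where
  "bipartite G \<longleftrightarrow>
     (\<exists>A B. A \<union> B = pverts G \<and> A \<inter> B = {} \<and> parcs G \<subseteq> A \<times> B \<union> B \<times> A)"

definition bipartite_swapping ::
    "'a pair_pre_digraph \<Rightarrow> 'b pair_pre_digraph \<Rightarrow> ('a \<Rightarrow> 'b \<times> 'b) \<Rightarrow> bool" where
  "bipartite_swapping G H p \<longleftrightarrow> bipartite (violated_subgraph G H p)"

definition Homs_bsp_two_copies ::
    "'a pair_pre_digraph \<Rightarrow> 'b pair_pre_digraph \<Rightarrow> ('a \<times> nat \<Rightarrow> 'b) set" where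
  "Homs_bsp_two_copies G H =
     {f \<in> Homs (two_copies G) H. bipartite_swapping G H (pair_of G f)}"

definition Homs_bsp_times_K2 ::
    "'a pair_pre_digraph \<Rightarrow> 'b pair_pre_digraph \<Rightarrow> ('a \<times> nat \<Rightarrow> 'b) set" where
  "Homs_bsp_times_K2 G H =
     {f \<in> Homs (times_K2 G) H. bipartite_swapping G H (pair_of G f)}"

definition swap_on :: "('a \<Rightarrow> 'b \<times> 'b) \<Rightarrow> 'a set \<Rightarrow> 'a \<Rightarrow> 'b \<times> 'b" where
  "swap_on p W = (\<lambda>v. if v \<in> W then prod.swap (p v) else p v)"

end

theory Submission
  imports Defs
begin

text \<open>
  Swapping the two entries at the vertices of a set \<open>W\<close> turns the copy \<open>u\<^sub>iv\<^sub>i\<close> of an edge \<open>uv\<close>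
  into the crossing \<open>u\<^sub>iv\<^bsub>1-i\<^esub>\<close> exactly when \<open>W\<close> separates \<open>u\<close> from \<open>v\<close>. A safe edge tolerates
  every combination of entries, so only the violated edges matter: if \<open>W\<close> is one side of a
  bipartition of the violated subgraph, then swapping on \<open>W\<close> exchanges homomorphisms from
  \<open>G \<squnion> G\<close> with homomorphisms from \<open>G \<times> K\<^sub>2\<close> (\<open>twist_two_copies\<close>, \<open>twist_times_K2\<close>).

  A violated subgraph may have many bipartitions, and choosing one separately for each homomorphism
  could destroy injectivity. However, swapping permutes the four combinations of entries at each
  edge and so does not change the violated subgraph (\<open>violated_subgraph_twist\<close>). Hence a side
  that depends only on the violated subgraph is the same for a homomorphism and for its image, and
  since swapping twice on the same set does nothing, the resulting map is its own inverse.
\<close>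

text \<open>
  This is \<^const>\<open>swap_on\<close> expressed on maps of the doubled vertex set, where it has to be
  restricted so that its values are again extensional.
\<close>

definition twist :: "'a set \<Rightarrow> 'a set \<Rightarrow> ('a \<times> nat \<Rightarrow> 'b) \<Rightarrow> 'a \<times> nat \<Rightarrow> 'b" where
  "twist V W f = (\<lambda>(v, i) \<in> V \<times> {0, 1}. f (v, if v \<in> W then 1 - i else i))"

definition cuts :: "'a set \<Rightarrow> 'a pair_pre_digraph \<Rightarrow> bool" where
  "cuts W G \<longleftrightarrow> (\<forall>(u, v) \<in> parcs G. u \<in> W \<longleftrightarrow> v \<notin> W)"

definition cut_side :: "'a pair_pre_digraph \<Rightarrow> 'a set" where
  "cut_side G = (SOME W. W \<subseteq> pverts G \<and> cuts W G)"

lemma cut_side: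
  assumes "bipartite G"
  shows "cut_side G \<subseteq> pverts G" and "cuts (cut_side G) G"
proof -
  obtain A B where "A \<union> B = pverts G" "A \<inter> B = {}" "parcs G \<subseteq> A \<times> B \<union> B \<times> A"
    using assms unfolding bipartite_def by blast
  then have "A \<subseteq> pverts G \<and> cuts A G"
    unfolding cuts_def by blast
  then have "cut_side G \<subseteq> pverts G \<and> cuts (cut_side G) G"
    unfolding cut_side_def by (rule someI)
  then show "cut_side G \<subseteq> pverts G" and "cuts (cut_side G) G"
    by simp_all
qed

lemma twist_apply:
  "v \<in> V \<Longrightarrow> i \<in> {0, 1} \<Longrightarrow> twist V W f (v, i) = f (v, if v \<in> W then 1 - i else i)"
  by (simp add: twist_def)

lemma twist_PiE:
  assumes "f \<in> V \<times> {0, 1} \<rightarrow>\<^sub>E X"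
  shows "twist V W f \<in> V \<times> {0, 1} \<rightarrow>\<^sub>E X"
proof (rule PiE_I)
  fix x :: "'a \<times> nat" assume "x \<in> V \<times> {0, 1}"
  then obtain v i where x: "x = (v, i)" "v \<in> V" "i \<in> {0, 1}" by blast
  then have "(v, if v \<in> W then 1 - i else i) \<in> V \<times> {0, 1}" by auto
  then show "twist V W f x \<in> X"
    unfolding x(1) twist_apply[OF x(2,3)] by (rule PiE_mem[OF assms])
qed (auto simp: twist_def)

lemma twist_twist:
  assumes "f \<in> V \<times> {0, 1} \<rightarrow>\<^sub>E X"
  shows "twist V W (twist V W f) = f"
proof
  fix x :: "'a \<times> nat"
  obtain v i where x: "x = (v, i)" by force
  show "twist V W (twist V W f) x = f x"
  proof (cases "v \<in> V \<and> i \<in> {0, 1}")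
    case True
    then show ?thesis unfolding x by (auto simp: twist_apply)
  next
    case False
    then have "x \<notin> V \<times> {0, 1}" unfolding x by simp
    then show ?thesis
      using PiE_arb[OF assms] by (auto simp: twist_def)
  qed
qed

text \<open>
  The inclusion matters off the vertex set, where the labeling is undefined and must not be
  swapped.
\<close>

lemma pair_of_twist:
  assumes "W \<subseteq> pverts G"
  shows "pair_of G (twist (pverts G) W f) = swap_on (pair_of G f) W"
proof
  fix v
  show "pair_of G (twist (pverts G) W f) v = swap_on (pair_of G f) W v"
    using assms by (cases "v \<in> pverts G") (auto simp: pair_of_def swap_on_def twist_apply)
qed

lemma safe_edge_pair_of:
  assumes "u \<in> pverts G" "v \<in> pverts G"
  shows "safe_edge H (pair_of G f) (u, v) \<longleftrightarrow>
           (\<forall>i \<in> {0, 1}. \<forall>j \<in> {0, 1}. (f (u, i), f (v, j)) \<in> parcs H)"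
  using assms by (auto simp: safe_edge_def entry_def pair_of_def)

lemma violated_subgraph_twist:
  assumes "pair_wf_digraph G"
  shows "violated_subgraph G H (pair_of G (twist (pverts G) W f)) =
         violated_subgraph G H (pair_of G f)"
proof -
  have "safe_edge H (pair_of G (twist (pverts G) W f)) (u, v) \<longleftrightarrow>
        safe_edge H (pair_of G f) (u, v)" if "(u, v) \<in> parcs G" for u v
  proof -
    have "u \<in> pverts G" "v \<in> pverts G"
      using pair_wf_digraph.in_arcsD1[OF assms that] pair_wf_digraph.in_arcsD2[OF assms that] .
    then show ?thesis
      by (auto simp: safe_edge_pair_of twist_apply)
  qed
  then show ?thesis
    unfolding violated_subgraph_def by auto
qed

lemma Homs_two_copies_iff:
  "f \<in> Homs (two_copies G) H \<longleftrightarrow> f \<in> pverts G \<times> {0, 1} \<rightarrow>\<^sub>E pverts H \<and>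
     (\<forall>u v. \<forall>i \<in> {0, 1}. (u, v) \<in> parcs G \<longrightarrow> (f (u, i), f (v, i)) \<in> parcs H)"
proof -
  have "(\<forall>(x, y) \<in> parcs (two_copies G). (f x, f y) \<in> parcs H) \<longleftrightarrow>
        (\<forall>u v. \<forall>i \<in> {0, 1}. (u, v) \<in> parcs G \<longrightarrow> (f (u, i), f (v, i)) \<in> parcs H)"
    (is "?L \<longleftrightarrow> ?R")
  proof (intro iffI allI ballI impI)
    fix u v and i :: nat
    assume L: ?L and "i \<in> {0, 1}" "(u, v) \<in> parcs G"
    then have "((u, i), (v, i)) \<in> parcs (two_copies G)"
      unfolding two_copies_def by simp
    from bspec[OF L this] show "(f (u, i), f (v, i)) \<in> parcs H"
      by simp
  next
    fix e
    assume R: ?R and "e \<in> parcs (two_copies G)"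
    then obtain u v i where "e = ((u, i), (v, i))" "i \<in> {0, 1}" "(u, v) \<in> parcs G"
      unfolding two_copies_def by auto
    with R show "case e of (x, y) \<Rightarrow> (f x, f y) \<in> parcs H"
      by auto
  qed
  moreover have "pverts (two_copies G) = pverts G \<times> {0, 1}"
    by (simp add: two_copies_def)
  ultimately show ?thesis
    by (simp only: Homs_def mem_Collect_eq)
qed

lemma Homs_times_K2_iff:
  "f \<in> Homs (times_K2 G) H \<longleftrightarrow> f \<in> pverts G \<times> {0, 1} \<rightarrow>\<^sub>E pverts H \<and>
     (\<forall>u v. \<forall>i \<in> {0, 1}. (u, v) \<in> parcs G \<longrightarrow> (f (u, i), f (v, 1 - i)) \<in> parcs H)"
proof -
  have "(\<forall>(x, y) \<in> parcs (times_K2 G). (f x, f y) \<in> parcs H) \<longleftrightarrow>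
        (\<forall>u v. \<forall>i \<in> {0, 1}. (u, v) \<in> parcs G \<longrightarrow> (f (u, i), f (v, 1 - i)) \<in> parcs H)"
    (is "?L \<longleftrightarrow> ?R")
  proof (intro iffI allI ballI impI)
    fix u v and i :: nat
    assume L: ?L and "i \<in> {0, 1}" "(u, v) \<in> parcs G"
    then have "((u, i), (v, 1 - i)) \<in> parcs (times_K2 G)"
      unfolding times_K2_def by simp
    from bspec[OF L this] show "(f (u, i), f (v, 1 - i)) \<in> parcs H"
      by simp
  next
    fix e
    assume R: ?R and "e \<in> parcs (times_K2 G)"
    then obtain u v i where "e = ((u, i), (v, 1 - i))" "i \<in> {0, 1}" "(u, v) \<in> parcs G"
      unfolding times_K2_def by auto
    with R show "case e of (x, y) \<Rightarrow> (f x, f y) \<in> parcs H"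
      by auto
  qed
  moreover have "pverts (times_K2 G) = pverts G \<times> {0, 1}"
    by (simp add: times_K2_def)
  ultimately show ?thesis
    by (simp only: Homs_def mem_Collect_eq)
qed

text \<open>
  An edge inside one side of the cut is safe, so its image may use any entries; across the cut
  exactly one endpoint is swapped, which exchanges the two kinds of edges.
\<close>

lemma twist_two_copies:
  assumes G: "pair_wf_digraph G"
    and f: "f \<in> Homs (two_copies G) H"
    and W: "cuts W (violated_subgraph G H (pair_of G f))"
  shows "twist (pverts G) W f \<in> Homs (times_K2 G) H"
proof -
  have "(twist (pverts G) W f (u, i), twist (pverts G) W f (v, 1 - i)) \<in> parcs H"
    if uv: "(u, v) \<in> parcs G" and i: "i \<in> {0, 1}" for u v and i :: nat
  proof -
    have V: "u \<in> pverts G" "v \<in> pverts G"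
      using pair_wf_digraph.in_arcsD1[OF G uv] pair_wf_digraph.in_arcsD2[OF G uv] .
    show ?thesis
    proof (cases "safe_edge H (pair_of G f) (u, v)")
      case True
      then show ?thesis using V i by (auto simp: safe_edge_pair_of twist_apply)
    next
      case False
      then have "u \<in> W \<longleftrightarrow> v \<notin> W"
        using W uv unfolding cuts_def violated_subgraph_def by auto
      then show ?thesis
        using f uv V i by (auto simp: Homs_two_copies_iff twist_apply)
    qed
  qed
  moreover have "twist (pverts G) W f \<in> pverts G \<times> {0, 1} \<rightarrow>\<^sub>E pverts H"
    using f by (simp only: Homs_two_copies_iff twist_PiE)
  ultimately show ?thesis
    by (simp only: Homs_times_K2_iff) simp
qed

lemma twist_times_K2:
  assumes G: "pair_wf_digraph G"
    and f: "f \<in> Homs (times_K2 G) H"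
    and W: "cuts W (violated_subgraph G H (pair_of G f))"
  shows "twist (pverts G) W f \<in> Homs (two_copies G) H"
proof -
  have "(twist (pverts G) W f (u, i), twist (pverts G) W f (v, i)) \<in> parcs H"
    if uv: "(u, v) \<in> parcs G" and i: "i \<in> {0, 1}" for u v and i :: nat
  proof -
    have V: "u \<in> pverts G" "v \<in> pverts G"
      using pair_wf_digraph.in_arcsD1[OF G uv] pair_wf_digraph.in_arcsD2[OF G uv] .
    show ?thesis
    proof (cases "safe_edge H (pair_of G f) (u, v)")
      case True
      then show ?thesis using V i by (auto simp: safe_edge_pair_of twist_apply)
    next
      case False
      then have "u \<in> W \<longleftrightarrow> v \<notin> W"
        using W uv unfolding cuts_def violated_subgraph_def by auto
      then show ?thesis
        using f uv V i by (auto simp: Homs_times_K2_iff twist_apply)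
    qed
  qed
  moreover have "twist (pverts G) W f \<in> pverts G \<times> {0, 1} \<rightarrow>\<^sub>E pverts H"
    using f by (simp only: Homs_times_K2_iff twist_PiE)
  ultimately show ?thesis
    by (simp only: Homs_two_copies_iff) simp
qed

theorem proposition3p7:
  fixes G :: "'a pair_pre_digraph" and H :: "'b pair_pre_digraph"
  assumes "pair_graph G" and "pair_pseudo_graph H"
  shows "\<exists>\<phi>. bij_betw \<phi> (Homs_bsp_two_copies G H) (Homs_bsp_times_K2 G H) \<and>
           (\<forall>f \<in> Homs_bsp_two_copies G H.
              \<exists>W \<subseteq> pverts G. pair_of G (\<phi> f) = swap_on (pair_of G f) W)"
proof -
  have G: "pair_wf_digraph G"
    using assms(1) by (simp add: pair_graph_def pair_fin_digraph_def pair_digraph_def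
        pair_loopfree_digraph_def pair_pseudo_graph_def)
  define side where "side f = cut_side (violated_subgraph G H (pair_of G f))" for f
  define \<phi> where "\<phi> f = twist (pverts G) (side f) f" for f
  have viol: "violated_subgraph G H (pair_of G (\<phi> f)) = violated_subgraph G H (pair_of G f)" for f
    unfolding \<phi>_def using violated_subgraph_twist[OF G] .
  then have side: "side (\<phi> f) = side f" for f
    unfolding side_def by simp
  have bsp: "bipartite_swapping G H (pair_of G (\<phi> f)) = bipartite_swapping G H (pair_of G f)" for f
    unfolding bipartite_swapping_def viol ..
  have side_cuts: "side f \<subseteq> pverts G" "cuts (side f) (violated_subgraph G H (pair_of G f))"
    if "bipartite_swapping G H (pair_of G f)" for f
    using cut_side[of "violated_subgraph G H (pair_of G f)"] that
    unfolding bipartite_swapping_def side_def by (simp_all add: violated_subgraph_def)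
  have involution: "\<phi> (\<phi> f) = f" if "f \<in> pverts G \<times> {0, 1} \<rightarrow>\<^sub>E pverts H" for f
    using twist_twist[OF that] side by (simp add: \<phi>_def)
  have "bij_betw \<phi> (Homs_bsp_two_copies G H) (Homs_bsp_times_K2 G H)"
  proof (rule bij_betw_byWitness[where f' = \<phi>])
    show "\<forall>f \<in> Homs_bsp_two_copies G H. \<phi> (\<phi> f) = f"
      using involution unfolding Homs_bsp_two_copies_def Homs_two_copies_iff by blast
    show "\<forall>f \<in> Homs_bsp_times_K2 G H. \<phi> (\<phi> f) = f"
      using involution unfolding Homs_bsp_times_K2_def Homs_times_K2_iff by blast
    show "\<phi> ` Homs_bsp_two_copies G H \<subseteq> Homs_bsp_times_K2 G H"
      using twist_two_copies[OF G] side_cuts(2) bsp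
      unfolding Homs_bsp_two_copies_def Homs_bsp_times_K2_def \<phi>_def by blast
    show "\<phi> ` Homs_bsp_times_K2 G H \<subseteq> Homs_bsp_two_copies G H"
      using twist_times_K2[OF G] side_cuts(2) bsp
      unfolding Homs_bsp_two_copies_def Homs_bsp_times_K2_def \<phi>_def by blast
  qed
  moreover have "\<exists>W \<subseteq> pverts G. pair_of G (\<phi> f) = swap_on (pair_of G f) W"
    if "f \<in> Homs_bsp_two_copies G H" for f
  proof -
    have "side f \<subseteq> pverts G"
      using that side_cuts(1) unfolding Homs_bsp_two_copies_def by blast
    then show ?thesis
      using pair_of_twist unfolding \<phi>_def by blast
  qed
  ultimately show ?thesis by blast
qed

end
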